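(* Let $f:\mathbb{R}^d\to\mathbb{R}$ be an $L$-smooth convex function having a minimizer $x_\star$, and let $f_\star=f(x_\star)$. Let $\tau_k=2\sqrt{k+3}$ and $\alpha_k=\frac12$ (formulas used for integers $k\ge-1$), and let $B_0=\alpha_0^2\tau_0^2\left(\frac{(\tau_0-1)^2}{\alpha_{-1}\tau_{-1}^2}-1\right)$. With $A_k,B_k$ defined from these as in the context, let $r>0$ be a constant such that $$\left(\frac{A_k}{B_k}+\frac{B_{k+1}+\alpha_{k+1}^2\tau_{k+1}^2}{A_k}\right)^{-1}\ge\frac{r}{\alpha_{k+1}}\qquad\text{for all }k\ge0.$$ Let $x_0\ne\tilde x_0$ and $L_0=\|\nabla f(x_0)-\nabla f(\tilde x_0)\|/\|x_0-\tilde x_0\|>0$, set $s_0=\frac{A_0}{\alpha_0\tau_0}\frac{r}{\alpha_1}\frac1{L_0}$, and let $$R=\|x_0-x_\star\|^2+\left(s_0^2(B_0+\alpha_0^2\tau_0^2)-\frac{s_0\alpha_0\tau_0}{2L}\right)\|\nabla f(x_0)\|^2 .$$ Then the sequences generated by AdaNAG-G (defined in the context) with these parameters satisfy $$f(x_k)-f_\star\le\frac1{s_{k+1}}\,\frac{1}{4\left(k+4-\frac{\sqrt{k+4}}2\right)}\,R=\mathcal{O}\left(\frac Lk\right),\qquad\min_{i\in\{1,\dots,k\}}\|\nabla f(x_i)\|^2=\mathcal{O}\left(\frac{L^2}{k^2}\right).$$ Here $s_k\ge\frac15\frac1L$ and $\liminf_{k\to\infty}s_k\ge\frac13\frac1L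$.
   Context: $f$ is $L$-smooth ($L>0$) if it is differentiable and $\nabla f$ is $L$-Lipschitz. AdaNAG-G with parameters $\{\tau_k\},\{\alpha_k\},B_0>0$: put $A_{-1}=0$, $A_k=\alpha_{k+1}\tau_{k+1}(\tau_{k+1}-1)$ for $k\ge0$, and $B_k=\alpha_k^2\tau_k^2\left(\frac{(\tau_k-1)^2}{\alpha_{k-1}\tau_{k-1}^2}-1\right)$ for $k\ge1$. Given $x_0=z_0\in\mathbb{R}^d$ and $s_0>0$, for $k=0,1,2,\dots$: $$y_{k+1}=x_k-s_k\nabla f(x_k),\quad z_{k+1}=z_k-s_k\alpha_k\tau_k\nabla f(x_k),\quad x_{k+1}=\left(1-\tfrac1{\tau_{k+1}}\right)y_{k+1}+\tfrac1{\tau_{k+1}}z_{k+1},$$ $$L_{k+1}=-\frac{\frac12\|\nabla f(x_{k+1})-\nabla f(x_k)\|^2}{f(x_{k+1})-f(x_k)+\langle\nabla f(x_{k+1}),x_k-x_{k+1}\rangle},$$ $$s_{k+1}=\min\left\{\frac{A_{k-1}+\alpha_k\tau_k}{A_k}s_k,\ \left(\frac{A_k}{B_k}+\frac{B_{k+1}+\alpha_{k+1}^2\tau_{k+1}^2}{A_k}\right)^{-1}\frac1{L_{k+1}}\right\}.$$ Conventions: $\frac00=0$ and $\frac a0=+\infty$ for $a>0$. The resulting algorithm is named AdaNAG-G$^{1/2}$.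
   Formalization: The bound s_k ≥ (1/5)(1/L) is stated only for r ≥ 1/10; for smaller admissible r it is false, since f(x) = (L/2)|x|² gives L_0 = L and s_1 ≤ 2r/L < 1/(5L). All other conclusions are stated for every admissible r > 0. *)

theory Defs
  imports "HOL-Analysis.Analysis"
begin

definition gradient :: "('a::euclidean_space \<Rightarrow> real) \<Rightarrow> 'a \<Rightarrow> 'a" where
  "gradient f x = (THE g. GDERIV f x :> g)"

definition L_smooth :: "real \<Rightarrow> ('a::euclidean_space \<Rightarrow> real) \<Rightarrow> bool" where
  "L_smooth L f \<longleftrightarrow> L > 0 \<and> (\<forall>x. f differentiable (at x)) \<and> L-lipschitz_on UNIV (gradient f)"

text \<open>
  The parameters \<open>\<alpha>\<close>, \<open>\<tau>\<close> are indexed by integers because indices down to -1 occur.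
\<close>

definition coeff_A :: "(int \<Rightarrow> real) \<Rightarrow> (int \<Rightarrow> real) \<Rightarrow> int \<Rightarrow> real" where
  "coeff_A \<alpha> \<tau> k = (if k = -1 then 0 else \<alpha> (k + 1) * \<tau> (k + 1) * (\<tau> (k + 1) - 1))"

definition formula_B :: "(int \<Rightarrow> real) \<Rightarrow> (int \<Rightarrow> real) \<Rightarrow> int \<Rightarrow> real" where
  "formula_B \<alpha> \<tau> k =
     (\<alpha> k)\<^sup>2 * (\<tau> k)\<^sup>2 * ((\<tau> k - 1)\<^sup>2 / (\<alpha> (k - 1) * (\<tau> (k - 1))\<^sup>2) - 1)"

definition coeff_B :: "(int \<Rightarrow> real) \<Rightarrow> (int \<Rightarrow> real) \<Rightarrow> real \<Rightarrow> int \<Rightarrow> real" where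
  "coeff_B \<alpha> \<tau> B\<^sub>0 k = (if k = 0 then B\<^sub>0 else formula_B \<alpha> \<tau> k)"

definition step_coeff :: "(int \<Rightarrow> real) \<Rightarrow> (int \<Rightarrow> real) \<Rightarrow> real \<Rightarrow> int \<Rightarrow> real" where
  "step_coeff \<alpha> \<tau> B\<^sub>0 k =
     inverse (coeff_A \<alpha> \<tau> k / coeff_B \<alpha> \<tau> B\<^sub>0 k
       + (coeff_B \<alpha> \<tau> B\<^sub>0 (k + 1) + (\<alpha> (k + 1))\<^sup>2 * (\<tau> (k + 1))\<^sup>2) / coeff_A \<alpha> \<tau> k)"

text \<open>
  Division on \<^typ>\<open>ereal\<close> satisfies \<open>0 / 0 = 0\<close> and \<open>a / 0 = \<infinity>\<close> for \<open>a > 0\<close>, which are the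
  conventions under which the local smoothness estimate and the step size rule are read.
  (On \<^typ>\<open>real\<close>, a vanishing estimate would give \<open>1 / 0 = 0\<close> and hence a zero step size.)
\<close>

definition local_smoothness :: "('a::euclidean_space \<Rightarrow> real) \<Rightarrow> 'a \<Rightarrow> 'a \<Rightarrow> ereal" where
  "local_smoothness f u v =
     - (ereal (1 / 2 * (norm (gradient f v - gradient f u))\<^sup>2)
        / ereal (f v - f u + gradient f v \<bullet> (u - v)))"

definition AdaNAG_G ::
  "('a::euclidean_space \<Rightarrow> real) \<Rightarrow> (int \<Rightarrow> real) \<Rightarrow> (int \<Rightarrow> real) \<Rightarrow> real
   \<Rightarrow> (nat \<Rightarrow> 'a) \<Rightarrow> (nat \<Rightarrow> 'a) \<Rightarrow> (nat \<Rightarrow> 'a) \<Rightarrow> (nat \<Rightarrow> real) \<Rightarrow> bool" where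
  "AdaNAG_G f \<alpha> \<tau> B\<^sub>0 x y z s \<longleftrightarrow>
     z 0 = x 0 \<and> s 0 > 0 \<and>
     (\<forall>k.
        y (k + 1) = x k - s k *\<^sub>R gradient f (x k) \<and>
        z (k + 1) = z k - (s k * \<alpha> (int k) * \<tau> (int k)) *\<^sub>R gradient f (x k) \<and>
        x (k + 1) = (1 - 1 / \<tau> (int k + 1)) *\<^sub>R y (k + 1) + (1 / \<tau> (int k + 1)) *\<^sub>R z (k + 1) \<and>
        ereal (s (k + 1)) =
          min (ereal ((coeff_A \<alpha> \<tau> (int k - 1) + \<alpha> (int k) * \<tau> (int k))
                      / coeff_A \<alpha> \<tau> (int k) * s k))
              (ereal (step_coeff \<alpha> \<tau> B\<^sub>0 (int k))
                      * (1 / local_smoothness f (x k) (x (k + 1)))))"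

end

theory Submission
  imports Defs "HOL-Real_Asymp.Real_Asymp"
begin

text \<open>
  With \<open>a\<^sub>k = \<alpha>\<^sub>k \<tau>\<^sub>k\<close>, the energy
  \<open>E\<^sub>k = s\<^sub>k\<^sub>+\<^sub>1 A\<^sub>k (f(x\<^sub>k) - f\<^sub>\<star>) + s\<^sub>k\<^sup>2 B\<^sub>k \<parallel>\<nabla>f(x\<^sub>k)\<parallel>\<^sup>2 / 2 + \<parallel>z\<^sub>k\<^sub>+\<^sub>1 - x\<^sub>\<star>\<parallel>\<^sup>2 / 2\<close>
  satisfies \<open>E\<^sub>0 \<le> R / 2\<close> and decreases by at least
  \<open>s\<^sub>k\<^sub>+\<^sub>1 s\<^sub>k A\<^sub>k \<parallel>\<nabla>f(x\<^sub>k)\<parallel>\<^sup>2 / 2\<close> in step \<open>k\<close>: the first step size bound lets the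
  function value gaps telescope, and the second one bounds \<open>\<parallel>\<nabla>f(x\<^sub>k\<^sub>+\<^sub>1) - \<nabla>f(x\<^sub>k)\<parallel>\<^sup>2\<close> by the
  Bregman divergence, so that a quadratic form in two consecutive gradients is negative. The gap
  estimate is \<open>E\<^sub>k \<le> E\<^sub>0\<close>, and summing the decrease, whose weights grow linearly in \<open>k\<close>, gives the
  gradient estimate. Cocoercivity gives \<open>L\<^sub>k \<le> L\<close> and hence \<open>s\<^sub>k \<ge> 2 r / L\<close>. The
  coefficients of \<open>1 / L\<^sub>k\<^sub>+\<^sub>1\<close> in the second bound tend to \<open>1/3\<close>, while the growth factors of
  the first bound exceed \<open>(k + 1) / k\<close> eventually, hence have a divergent product; this yields the
  limit inferior.
\<close>

subsection \<open>Smooth convex functions\<close>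

text \<open>The adjoint of the derivative, applied to 1, represents it as an inner product;
  uniqueness of derivatives then justifies the definite description in
  \<open>gradient\<close>.\<close>

lemma GDERIV_gradient:
  fixes f :: "'a::euclidean_space \<Rightarrow> real"
  assumes "f differentiable (at x)"
  shows "GDERIV f x :> gradient f x"
proof -
  obtain f' where f': "(f has_derivative f') (at x)"
    using assms by (auto simp: differentiable_def)
  then have "linear f'"
    by (simp add: has_derivative_bounded_linear bounded_linear.linear)
  then have "(\<lambda>h. h \<bullet> adjoint f' 1) = f'"
    using adjoint_works[of f' _ "1 :: real"] by auto
  with f' have g: "GDERIV f x :> adjoint f' 1"
    by (simp only: gderiv_def)
  have "g' = adjoint f' 1" if "GDERIV f x :> g'" for g'
  proof -
    have "(\<lambda>h. h \<bullet> g') = (\<lambda>h. h \<bullet> adjoint f' 1)"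
      using that g unfolding gderiv_def by (rule has_derivative_unique)
    then show ?thesis
      by (simp add: fun_eq_iff vector_eq_ldot)
  qed
  with g have "gradient f x = adjoint f' 1"
    unfolding gradient_def by (rule the_equality)
  with g show ?thesis by simp
qed

lemma GDERIV_gradient_line:
  fixes f :: "'a::euclidean_space \<Rightarrow> real"
  assumes "\<And>x. f differentiable (at x)"
  shows "DERIV (\<lambda>t. f (x + t *\<^sub>R d)) t :> gradient f (x + t *\<^sub>R d) \<bullet> d"
proof -
  have "((\<lambda>t. x + t *\<^sub>R d) has_derivative (\<lambda>h. h *\<^sub>R d)) (at t)"
    by (auto intro!: derivative_eq_intros)
  moreover have "(f has_derivative (\<lambda>h. h \<bullet> gradient f (x + t *\<^sub>R d))) (at (x + t *\<^sub>R d))"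
    using GDERIV_gradient[OF assms] by (simp add: gderiv_def)
  ultimately have "((\<lambda>t. f (x + t *\<^sub>R d)) has_derivative
      (\<lambda>h. (h *\<^sub>R d) \<bullet> gradient f (x + t *\<^sub>R d))) (at t)"
    by (rule has_derivative_compose)
  moreover have "(\<lambda>h. (h *\<^sub>R d) \<bullet> gradient f (x + t *\<^sub>R d)) = (*) (gradient f (x + t *\<^sub>R d) \<bullet> d)"
    by (simp add: fun_eq_iff inner_commute)
  ultimately show ?thesis
    by (simp add: has_field_derivative_def)
qed

text \<open>Restriction to the line through \<open>x\<close> and \<open>y\<close> reduces this to
  the tangent inequality in one variable.\<close>

lemma convex_on_gradient_le:
  fixes f :: "'a::euclidean_space \<Rightarrow> real"
  assumes diff: "\<And>x. f differentiable (at x)" and conv: "convex_on UNIV f"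
  shows "f x + gradient f x \<bullet> (y - x) \<le> f y"
proof -
  define h where "h = (\<lambda>t. f (x + t *\<^sub>R (y - x)))"
  have "convex_on UNIV h"
  proof (rule convex_onI)
    fix t a b :: real assume "0 < t" "t < 1"
    have "x + ((1 - t) * a + t * b) *\<^sub>R (y - x)
        = (1 - t) *\<^sub>R (x + a *\<^sub>R (y - x)) + t *\<^sub>R (x + b *\<^sub>R (y - x))"
      by (simp add: algebra_simps)
    then show "h ((1 - t) *\<^sub>R a + t *\<^sub>R b) \<le> (1 - t) * h a + t * h b"
      using convex_onD[OF conv, of t "x + a *\<^sub>R (y - x)" "x + b *\<^sub>R (y - x)"] \<open>0 < t\<close> \<open>t < 1\<close>
      by (simp add: h_def)
  qed auto
  moreover have "DERIV h 0 :> gradient f x \<bullet> (y - x)"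
    using GDERIV_gradient_line[OF diff, of x "y - x" 0] by (simp add: h_def)
  ultimately have "gradient f x \<bullet> (y - x) * (1 - 0) \<le> h 1 - h 0"
    by (intro convex_on_imp_above_tangent[of UNIV]) auto
  then show ?thesis
    by (simp add: h_def)
qed

lemma L_smooth_norm_gradient_diff_le:
  assumes "L_smooth L f"
  shows "norm (gradient f x - gradient f y) \<le> L * norm (x - y)"
  using assms lipschitz_onD[of L UNIV "gradient f" x y] by (simp add: L_smooth_def dist_norm)

lemma L_smooth_le:
  fixes f :: "'a::euclidean_space \<Rightarrow> real"
  assumes L: "L_smooth L f"
  shows "f y \<le> f x + gradient f x \<bullet> (y - x) + L / 2 * (norm (y - x))\<^sup>2"
proof -
  define d where "d = y - x"
  \<comment> \<open>The claim is \<open>h 1 \<le> h 0\<close>; the Lipschitz bound makes the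
    derivative of \<open>h\<close> nonpositive on [0, 1].\<close>
  define h where "h = (\<lambda>t. f (x + t *\<^sub>R d) - t * (gradient f x \<bullet> d) - L / 2 * t\<^sup>2 * (norm d)\<^sup>2)"
  have diff: "\<And>x. f differentiable (at x)"
    using L by (simp add: L_smooth_def)
  have "h 1 \<le> h 0"
  proof (rule DERIV_nonpos_imp_nonincreasing[where f = h and a = 0 and b = 1])
    fix t :: real assume t: "0 \<le> t" "t \<le> 1"
    define h' where "h' = gradient f (x + t *\<^sub>R d) \<bullet> d - gradient f x \<bullet> d - L * t * (norm d)\<^sup>2"
    have "DERIV h t :> h'"
      unfolding h_def h'_def
      by (rule derivative_eq_intros GDERIV_gradient_line[OF diff] refl)+ simp
    moreover have "h' \<le> 0"
    proof -
      have "gradient f (x + t *\<^sub>R d) \<bullet> d - gradient f x \<bullet> d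
          \<le> norm (gradient f (x + t *\<^sub>R d) - gradient f x) * norm d"
        by (metis inner_diff_left norm_cauchy_schwarz)
      also have "\<dots> \<le> (L * (t * norm d)) * norm d"
        using L_smooth_norm_gradient_diff_le[OF L, of "x + t *\<^sub>R d" x] t
        by (intro mult_right_mono) auto
      finally show ?thesis
        by (simp add: h'_def power2_eq_square algebra_simps)
    qed
    ultimately show "\<exists>D. DERIV h t :> D \<and> D \<le> 0" by blast
  qed simp
  then show ?thesis
    by (simp add: h_def d_def algebra_simps)
qed

text \<open>The quadratic upper bound at \<open>u\<close> lies above the tangent at
  \<open>v\<close>; \<open>w\<close> is the point where their difference is smallest.\<close>

lemma L_smooth_convex_cocoercive:
  fixes f :: "'a::euclidean_space \<Rightarrow> real"
  assumes L: "L_smooth L f" and conv: "convex_on UNIV f"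
  shows "f v + gradient f v \<bullet> (u - v) + (norm (gradient f u - gradient f v))\<^sup>2 / (2 * L) \<le> f u"
proof -
  define e where "e = gradient f u - gradient f v"
  define w where "w = u - (1 / L) *\<^sub>R e"
  have Lpos: "L > 0" and diff: "\<And>x. f differentiable (at x)"
    using L by (auto simp: L_smooth_def)
  have wu: "w - u = - (1 / L) *\<^sub>R e"
    by (simp add: w_def)
  have "f v + gradient f v \<bullet> (w - v) \<le> f w"
    by (rule convex_on_gradient_le[OF diff conv])
  also have "f w \<le> f u + gradient f u \<bullet> (w - u) + L / 2 * (norm (w - u))\<^sup>2"
    by (rule L_smooth_le[OF L])
  also have "L / 2 * (norm (w - u))\<^sup>2 = (e \<bullet> e) / (2 * L)"
    using Lpos unfolding wu power2_norm_eq_inner by (simp add: field_simps)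
  finally have "f v + gradient f v \<bullet> (u - v) - e \<bullet> (w - u) \<le> f u + (e \<bullet> e) / (2 * L)"
    by (simp add: e_def algebra_simps inner_diff_left inner_diff_right)
  then show ?thesis
    using Lpos unfolding wu e_def[symmetric]
    by (simp add: power2_norm_eq_inner divide_simps)
qed

lemma gradient_at_minimizer:
  fixes f :: "'a::euclidean_space \<Rightarrow> real"
  assumes L: "L_smooth L f" and min: "\<And>u. f m \<le> f u"
  shows "gradient f m = 0"
proof -
  have Lpos: "L > 0"
    using L by (simp add: L_smooth_def)
  \<comment> \<open>A gradient step of size \<open>1 / L\<close> would go below the minimum unless
    the gradient vanishes.\<close>
  have "f m \<le> f (m - (1 / L) *\<^sub>R gradient f m)"
    by (rule min)
  also have "\<dots> \<le> f m - (gradient f m \<bullet> gradient f m) / (2 * L)"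
    using L_smooth_le[OF L, of "m - (1 / L) *\<^sub>R gradient f m" m] Lpos
    unfolding power2_norm_eq_inner by (simp add: field_simps)
  finally have "gradient f m \<bullet> gradient f m \<le> 0"
    using Lpos by (simp add: divide_le_0_iff)
  then show ?thesis
    using inner_ge_zero[of "gradient f m"] by (metis inner_eq_zero_iff order_antisym)
qed

text \<open>Replaces the extended-real minimum by real inequalities. The lower bound on
  \<open>t\<close> is cocoercivity: the local estimate is at most \<open>L\<close>.\<close>

lemma step_size_rule:
  fixes f :: "'a::euclidean_space \<Rightarrow> real"
  assumes L: "L_smooth L f" and conv: "convex_on UNIV f" and c: "c > 0"
    and t: "ereal t = min (ereal q) (ereal c * (1 / local_smoothness f u v))"
  shows "t \<le> q" and "min q (c / L) \<le> t"
    and "t * (norm (gradient f v - gradient f u))\<^sup>2 / 2 \<le> c * (f u - f v - gradient f v \<bullet> (u - v))"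
proof -
  define N where "N = (norm (gradient f v - gradient f u))\<^sup>2 / 2"
  define D where "D = f u - f v - gradient f v \<bullet> (u - v)"
  have Lpos: "L > 0"
    using L by (simp add: L_smooth_def)
  have ND: "N / L \<le> D"
    using L_smooth_convex_cocoercive[OF L conv, of v u]
    by (simp add: N_def D_def norm_minus_commute)
  have N0: "N \<ge> 0"
    by (simp add: N_def)
  have D0: "D \<ge> 0"
    using ND N0 Lpos by (smt (verit) divide_nonneg_pos)
  have ls: "local_smoothness f u v = - (ereal N / ereal (- D))"
    by (simp add: local_smoothness_def N_def D_def)
  have "t \<le> q \<and> min q (c / L) \<le> t \<and> t * N \<le> c * D"
  proof (cases "N = 0")
    \<comment> \<open>Whether or not \<open>D = 0\<close>, the estimate is 0 (by
      \<open>0 / 0 = 0\<close>), so the second entry of the minimum is infinite.\<close>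
    case True
    then have "local_smoothness f u v = 0"
      by (simp add: ls flip: zero_ereal_def)
    then have "t = q"
      using t c by (simp add: divide_ereal_def)
    with True c D0 show ?thesis by simp
  next
    case False
    then have "N > 0" using N0 by simp
    with ND Lpos have "D > 0"
      by (smt (verit) divide_pos_pos)
    have "local_smoothness f u v = ereal (N / D)"
      using \<open>D > 0\<close> by (simp add: ls)
    then have t': "t = min q (c * D / N)"
      using t \<open>N > 0\<close> \<open>D > 0\<close> by (simp add: one_ereal_def min_def split: if_splits)
    have "c / L \<le> c * D / N"
      using ND \<open>N > 0\<close> Lpos c by (simp add: field_simps)
    moreover have "t * N \<le> c * D / N * N"
      using t' N0 by (intro mult_right_mono) auto
    ultimately show ?thesis
      using t' \<open>N > 0\<close> by auto
  qed
  then show "t \<le> q" "min q (c / L) \<le> t"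
    "t * (norm (gradient f v - gradient f u))\<^sup>2 / 2 \<le> c * (f u - f v - gradient f v \<bullet> (u - v))"
    by (auto simp: N_def D_def)
qed

subsection \<open>Energy decrease\<close>

text \<open>
  The two squares \<open>s\<^sup>2 A\<^sup>2 / B \<parallel>g' - g\<parallel>\<^sup>2\<close> and \<open>t\<^sup>2 B \<parallel>g\<parallel>\<^sup>2\<close> absorb the cross term, since
  its coefficient \<open>s (A t - s P)\<close> is at most \<open>s A t\<close>.
\<close>
lemma lyapunov_quadratic_form:
  fixes g g' :: "'a::real_inner"
  assumes "A > 0" "B > 0" "P \<ge> 0" "s \<ge> 0" "t \<ge> 0" and sP: "s * P \<le> A * t"
  shows "s\<^sup>2 * P * (norm g')\<^sup>2 - t\<^sup>2 * B * (norm g)\<^sup>2 - 2 * s * t * A * (g' \<bullet> g)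
      \<le> s\<^sup>2 * (A\<^sup>2 / B + P) * (norm (g' - g))\<^sup>2 - s * t * A * (norm g)\<^sup>2"
proof -
  define d where "d = g' - g"
  define e where "e = A * t - s * P"
  have e: "0 \<le> e" "e \<le> A * t"
    using assms by (auto simp: e_def)
  \<comment> \<open>The weights are chosen so that the mixed term is exactly the cross term
    \<open>2 * s * e * (d \<bullet> g)\<close> of the claim.\<close>
  have "0 \<le> (norm ((s * A) *\<^sub>R d + (e * B / A) *\<^sub>R g))\<^sup>2 / B"
    using assms by simp
  also have "\<dots> = s\<^sup>2 * (A\<^sup>2 / B) * (d \<bullet> d) + 2 * s * e * (d \<bullet> g) + e\<^sup>2 * B / A\<^sup>2 * (g \<bullet> g)"
    using assms unfolding power2_norm_eq_inner
    by (simp add: inner_add_left inner_add_right inner_commute[of g d] power2_eq_square divide_simps)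
      (simp add: algebra_simps)
  finally have 1: "0 \<le> \<dots>" .
  have "e\<^sup>2 \<le> (A * t)\<^sup>2"
    using e by (rule power_mono[rotated])
  then have "e\<^sup>2 * B / A\<^sup>2 \<le> t\<^sup>2 * B"
    using assms by (simp add: divide_simps power_mult_distrib)
      (simp add: algebra_simps)
  then have 2: "e\<^sup>2 * B / A\<^sup>2 * (g \<bullet> g) \<le> t\<^sup>2 * B * (g \<bullet> g)"
    by (rule mult_right_mono) simp
  \<comment> \<open>This is what remains of the \<open>g \<bullet> g\<close> terms once
    \<open>t\<^sup>2 * B\<close> has been spent on the square.\<close>
  have "0 \<le> s * e * (g \<bullet> g)"
    using assms e by simp
  then have 3: "s\<^sup>2 * P * (g \<bullet> g) \<le> s * t * A * (g \<bullet> g)"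
    by (simp add: e_def algebra_simps power2_eq_square)
  have g': "g' = d + g"
    by (simp add: d_def)
  show ?thesis
    using 1 2 3 unfolding d_def[symmetric] unfolding g' power2_norm_eq_inner e_def
      inner_add_left inner_add_right inner_commute[of g d]
    by (simp add: algebra_simps power2_eq_square)
qed

text \<open>
  AdaNAG-G with \<open>y\<close> eliminated and \<open>a k = \<alpha> k * \<tau> k\<close>; \<open>x_Suc\<close> is the definition of
  \<open>x (Suc k)\<close> multiplied by \<open>a (Suc k) * \<tau> (Suc k)\<close>, as \<open>A k = a (Suc k) * (\<tau> (Suc k) - 1)\<close>.
\<close>
locale adanag_iteration =
  fixes f :: "'a::euclidean_space \<Rightarrow> real" and L :: real and m :: 'a
    and a A B :: "nat \<Rightarrow> real" and x z :: "nat \<Rightarrow> 'a" and s :: "nat \<Rightarrow> real"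
  assumes smooth: "L_smooth L f" and convex: "convex_on UNIV f" and minimizer: "f m \<le> f u"
    and a_nonneg: "a k \<ge> 0" and A_pos: "A k > 0" and B_pos: "B k > 0"
    and z_0: "z 0 = x 0"
    and z_Suc: "z (Suc k) = z k - (s k * a k) *\<^sub>R gradient f (x k)"
    and x_Suc: "a (Suc k) *\<^sub>R (z (Suc k) - x (Suc k))
      = A k *\<^sub>R (x (Suc k) - (x k - s k *\<^sub>R gradient f (x k)))"
    and s_pos: "s k > 0"
    and s_1: "s (Suc 0) * A 0 \<le> s 0 * a 0"
    and s_Suc: "s (Suc (Suc k)) * A (Suc k) \<le> s (Suc k) * (A k + a (Suc k))"
    and s_ratio: "s (Suc k) * (B (Suc k) + (a (Suc k))\<^sup>2) \<le> A k * s k"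
    and s_curvature: "s (Suc k) * (norm (gradient f (x (Suc k)) - gradient f (x k)))\<^sup>2 / 2
      \<le> inverse (A k / B k + (B (Suc k) + (a (Suc k))\<^sup>2) / A k)
        * (f (x k) - f (x (Suc k)) - gradient f (x (Suc k)) \<bullet> (x k - x (Suc k)))"
begin

definition energy :: "nat \<Rightarrow> real" where
  "energy k = s (Suc k) * A k * (f (x k) - f m)
    + (s k)\<^sup>2 * B k * (norm (gradient f (x k)))\<^sup>2 / 2 + (norm (z (Suc k) - m))\<^sup>2 / 2"

lemma norm_z_Suc:
  "(norm (z (Suc k) - m))\<^sup>2 = (norm (z k - m))\<^sup>2
    - 2 * s k * a k * (gradient f (x k) \<bullet> (z k - m)) + (s k * a k)\<^sup>2 * (norm (gradient f (x k)))\<^sup>2"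
  unfolding z_Suc power2_norm_eq_inner
  by (simp add: inner_commute algebra_simps power2_eq_square)

text \<open>Cocoercivity between \<open>x 0\<close> and the minimizer yields the negative gradient
  term, and \<open>s_1\<close> lets the inner product absorb the gap.\<close>

lemma energy_0:
  "energy 0 \<le> ((norm (x 0 - m))\<^sup>2
    + ((s 0)\<^sup>2 * (B 0 + (a 0)\<^sup>2) - s 0 * a 0 / (2 * L)) * (norm (gradient f (x 0)))\<^sup>2) / 2"
proof -
  define G p \<phi> e I where "G = (norm (gradient f (x 0)))\<^sup>2" and "p = s 0 * a 0"
    and "\<phi> = f (x 0) - f m" and "e = G / (4 * L)" and "I = gradient f (x 0) \<bullet> (x 0 - m)"
  define U where "U = (s 0)\<^sup>2 * B 0 * G"
  define T where "T = ((s 0)\<^sup>2 * (B 0 + (a 0)\<^sup>2) - s 0 * a 0 / (2 * L)) * G"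
  have Lpos: "L > 0"
    using smooth by (simp add: L_smooth_def)
  have p: "p \<ge> 0"
    using s_pos[of 0] a_nonneg[of 0] by (simp add: p_def)
  have "gradient f m = 0"
    using gradient_at_minimizer[OF smooth minimizer] .
  then have "\<phi> + 2 * e \<le> I"
    using L_smooth_convex_cocoercive[OF smooth convex, of "x 0" m]
    by (simp add: G_def \<phi>_def e_def I_def inner_diff_right)
  then have "p * \<phi> + 2 * (p * e) \<le> p * I"
    using mult_left_mono[of "\<phi> + 2 * e" I p] p by (simp add: algebra_simps)
  moreover have "s (Suc 0) * A 0 * \<phi> \<le> p * \<phi>"
    using s_1 minimizer[of "x 0"] by (intro mult_right_mono) (auto simp: p_def \<phi>_def)
  \<comment> \<open>Half of the gain \<open>2 * (p * e)\<close> appears in the claim; the other half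
    is dropped.\<close>
  moreover have "0 \<le> p * e"
    using p Lpos by (simp add: G_def e_def)
  moreover have "T = U + p\<^sup>2 * G - 2 * (p * e)"
    using Lpos by (simp add: T_def U_def e_def p_def field_simps power_mult_distrib)
  moreover have "energy 0 = s (Suc 0) * A 0 * \<phi> + U / 2
      + ((norm (x 0 - m))\<^sup>2 - 2 * (p * I) + p\<^sup>2 * G) / 2"
    unfolding energy_def norm_z_Suc z_0 by (simp add: G_def U_def p_def \<phi>_def I_def)
  ultimately show ?thesis
    unfolding G_def[symmetric] T_def[symmetric] add_divide_distrib diff_divide_distrib by linarith
qed

text \<open>Four estimates are added: convexity towards \<open>m\<close> (\<open>1\<close>), the
  growth bound (\<open>2\<close>), the curvature bound (\<open>3\<close>) and the quadratic form
  (\<open>4\<close>). The terms in \<open>Q\<close>, of unknown sign, cancel between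
  \<open>1\<close> and \<open>3\<close>.\<close>

lemma energy_Suc:
  "energy (Suc k) + s (Suc k) * s k * A k * (norm (gradient f (x k)))\<^sup>2 / 2 \<le> energy k"
proof -
  define g g' where "g = gradient f (x k)" and "g' = gradient f (x (Suc k))"
  define t \<sigma> where "t = s k" and "\<sigma> = s (Suc k)"
  define a' P where "a' = a (Suc k)" and "P = B (Suc k) + a'\<^sup>2"
  define \<phi> \<phi>' where "\<phi> = f (x k) - f m" and "\<phi>' = f (x (Suc k)) - f m"
  define Q where "Q = g' \<bullet> (x (Suc k) - x k)"
  note A = A_pos[of k] and B = B_pos[of k]
  have nonneg: "0 \<le> t" "0 \<le> \<sigma>" "0 \<le> a'" "0 \<le> P" "0 \<le> \<phi>'"
    using s_pos[of k] s_pos[of "Suc k"] a_nonneg[of "Suc k"] B_pos[of "Suc k"] minimizer[of "x (Suc k)"]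
    by (auto simp: t_def \<sigma>_def a'_def P_def \<phi>'_def)
  \<comment> \<open>The coupling \<open>x_Suc\<close> eliminates \<open>z (Suc k)\<close> and
    produces the cross term of the two gradients.\<close>
  have "a' *\<^sub>R (z (Suc k) - m) = a' *\<^sub>R (x (Suc k) - m) + A k *\<^sub>R (x (Suc k) - x k + t *\<^sub>R g)"
    using x_Suc[of k] by (simp add: a'_def t_def g_def algebra_simps)
  then have "g' \<bullet> (a' *\<^sub>R (z (Suc k) - m))
      = g' \<bullet> (a' *\<^sub>R (x (Suc k) - m) + A k *\<^sub>R (x (Suc k) - x k + t *\<^sub>R g))"
    by simp
  then have z: "a' * (g' \<bullet> (z (Suc k) - m))
      = a' * (g' \<bullet> (x (Suc k) - m)) + A k * Q + A k * t * (g' \<bullet> g)"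
    unfolding Q_def inner_add_right inner_scaleR_right by (simp add: algebra_simps)
  have "\<phi>' \<le> g' \<bullet> (x (Suc k) - m)"
    using convex_on_gradient_le[of f "x (Suc k)" m] smooth convex
    by (simp add: L_smooth_def g'_def \<phi>'_def inner_diff_right)
  then have "\<sigma> * (a' * \<phi>') \<le> \<sigma> * (a' * (g' \<bullet> (x (Suc k) - m)))"
    using nonneg by (intro mult_left_mono)
  then have 1: "\<sigma> * a' * \<phi>' + \<sigma> * A k * Q + \<sigma> * t * A k * (g' \<bullet> g)
      \<le> \<sigma> * (a' * (g' \<bullet> (z (Suc k) - m)))"
    unfolding z by (simp add: algebra_simps)
  have 2: "s (Suc (Suc k)) * A (Suc k) * \<phi>' \<le> \<sigma> * (A k + a') * \<phi>'"
    using s_Suc[of k] nonneg by (intro mult_right_mono) (auto simp: \<sigma>_def a'_def)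
  define c where "c = A k / B k + P / A k"
  have "c > 0"
    using A B nonneg by (simp add: c_def add_pos_nonneg)
  have "\<sigma> * (norm (g' - g))\<^sup>2 / 2 \<le> inverse c * (\<phi> - \<phi>' + Q)"
    using s_curvature[of k]
    by (simp add: \<sigma>_def g_def g'_def c_def P_def a'_def \<phi>_def \<phi>'_def Q_def inner_diff_right algebra_simps)
  \<comment> \<open>The weight cancels \<open>inverse c\<close> and leaves \<open>A k * c\<close>,
    the coefficient needed in \<open>4\<close>.\<close>
  then have "(\<sigma> * A k * c) * (\<sigma> * (norm (g' - g))\<^sup>2 / 2) \<le> (\<sigma> * A k * c) * (inverse c * (\<phi> - \<phi>' + Q))"
    using A \<open>c > 0\<close> nonneg by (intro mult_left_mono) auto
  also have "\<dots> = \<sigma> * A k * (\<phi> - \<phi>' + Q)"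
    using \<open>c > 0\<close> by simp
  finally have 3: "\<sigma>\<^sup>2 * (A k * c) * (norm (g' - g))\<^sup>2 / 2 \<le> \<sigma> * A k * (\<phi> - \<phi>' + Q)"
    by (simp add: algebra_simps power2_eq_square)
  have "A k * c = (A k)\<^sup>2 / B k + P"
    using A by (simp add: c_def power2_eq_square algebra_simps)
  then have 4: "\<sigma>\<^sup>2 * P * (norm g')\<^sup>2 - t\<^sup>2 * B k * (norm g)\<^sup>2 - 2 * \<sigma> * t * A k * (g' \<bullet> g)
      \<le> \<sigma>\<^sup>2 * (A k * c) * (norm (g' - g))\<^sup>2 - \<sigma> * t * A k * (norm g)\<^sup>2"
    using lyapunov_quadratic_form[OF A B, of P \<sigma> t g' g] s_ratio[of k] nonneg
    by (simp add: t_def \<sigma>_def P_def a'_def)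
  have "(norm (z (Suc (Suc k)) - m))\<^sup>2 = (norm (z (Suc k) - m))\<^sup>2
      - 2 * (\<sigma> * (a' * (g' \<bullet> (z (Suc k) - m)))) + \<sigma>\<^sup>2 * a'\<^sup>2 * (norm g')\<^sup>2"
    unfolding norm_z_Suc by (simp add: \<sigma>_def a'_def g'_def power_mult_distrib)
  moreover have "\<sigma>\<^sup>2 * P * (norm g')\<^sup>2 = \<sigma>\<^sup>2 * B (Suc k) * (norm g')\<^sup>2 + \<sigma>\<^sup>2 * a'\<^sup>2 * (norm g')\<^sup>2"
    by (simp add: P_def algebra_simps)
  moreover have "\<sigma> * (A k + a') * \<phi>' = \<sigma> * A k * \<phi>' + \<sigma> * a' * \<phi>'"
    "\<sigma> * A k * (\<phi> - \<phi>' + Q) = \<sigma> * A k * \<phi> - \<sigma> * A k * \<phi>' + \<sigma> * A k * Q"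
    by (simp_all add: algebra_simps)
  ultimately show ?thesis
    using 1 2 3 4
    unfolding energy_def g_def[symmetric] g'_def[symmetric] t_def[symmetric] \<sigma>_def[symmetric]
      \<phi>_def[symmetric] \<phi>'_def[symmetric]
    by linarith
qed

section \<open>Consequences of the energy decrease\<close>

lemma energy_sum:
  "energy n + (\<Sum>k<n. s (Suc k) * s k * A k * (norm (gradient f (x k)))\<^sup>2 / 2) \<le> energy 0"
proof (induction n)
  case (Suc n)
  then show ?case
    using energy_Suc[of n] by simp
qed simp

lemma energy_ge: "s (Suc k) * A k * (f (x k) - f m) \<le> energy k"
  using B_pos[of k] by (simp add: energy_def)

lemma energy_nonneg: "0 \<le> energy k"
  using energy_ge[of k] s_pos[of "Suc k"] A_pos[of k] minimizer[of "x k"]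
  by (smt (verit) mult_nonneg_nonneg)

lemma gap_le: "s (Suc k) * A k * (f (x k) - f m) \<le> energy 0"
proof -
  have "0 \<le> (\<Sum>j<k. s (Suc j) * s j * A j * (norm (gradient f (x j)))\<^sup>2 / 2)"
    using s_pos A_pos by (intro sum_nonneg) (simp add: less_imp_le)
  then show ?thesis
    using energy_sum[of k] energy_ge[of k] by linarith
qed

text \<open>The minimum is below every gradient term, so the decrease in step \<open>j\<close> is at
  least \<open>l\<^sup>2 / 2 * j\<close> times it, and these weights sum to order
  \<open>k\<^sup>2\<close>.\<close>

lemma min_gradient_le:
  assumes "l > 0" "\<And>j. 1 \<le> j \<Longrightarrow> l \<le> s j" "\<And>j. real j \<le> A j" "1 \<le> k"
  shows "Min ((\<lambda>i. (norm (gradient f (x i)))\<^sup>2) ` {1..k}) \<le> 4 * energy 0 / (l\<^sup>2 * (real k)\<^sup>2)"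
proof -
  define M where "M = Min ((\<lambda>i. (norm (gradient f (x i)))\<^sup>2) ` {1..k})"
  define S where "S = (\<lambda>j. s (Suc j) * s j * A j * (norm (gradient f (x j)))\<^sup>2 / 2)"
  have M: "M \<le> (norm (gradient f (x j)))\<^sup>2" if "j \<in> {1..k}" for j
    unfolding M_def using that by (intro Min_le) auto
  have M0: "0 \<le> M"
    unfolding M_def using assms(4) by (subst Min_ge_iff) auto
  have S0: "0 \<le> S j" for j
    using s_pos A_pos by (simp add: S_def less_imp_le)
  have "l\<^sup>2 * M / 2 * real j \<le> S j" if "j \<in> {1..k}" for j
  proof -
    have "l * l * real j * M \<le> s (Suc j) * s j * A j * (norm (gradient f (x j)))\<^sup>2"
      using that assms s_pos[of j] s_pos[of "Suc j"] A_pos[of j] M[OF that] M0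
      by (intro mult_mono mult_nonneg_nonneg) (auto simp: less_imp_le)
    then show ?thesis
      by (simp add: S_def power2_eq_square algebra_simps)
  qed
  then have "(\<Sum>j=1..k. l\<^sup>2 * M / 2 * real j) \<le> (\<Sum>j=1..k. S j)"
    by (intro sum_mono)
  \<comment> \<open>Adds the nonnegative term at index 0, to match the range in
    \<open>energy_sum\<close>.\<close>
  also have "\<dots> \<le> (\<Sum>j<Suc k. S j)"
    using S0 by (intro sum_mono2) auto
  also have "\<dots> \<le> energy 0"
    using energy_sum[of "Suc k"] energy_nonneg[of "Suc k"] by (simp add: S_def)
  finally have "l\<^sup>2 * M / 2 * (\<Sum>j=1..k. real j) \<le> energy 0"
    by (simp add: sum_distrib_left)
  moreover have "real k * real k / 2 \<le> (\<Sum>j=1..k. real j)"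
    by (induction k) (auto simp: field_simps)
  then have "l\<^sup>2 * M / 2 * (real k * real k / 2) \<le> l\<^sup>2 * M / 2 * (\<Sum>j=1..k. real j)"
    using M0 by (intro mult_left_mono) auto
  ultimately have "l\<^sup>2 * M / 2 * (real k * real k / 2) \<le> energy 0"
    by linarith
  then show ?thesis
    using assms unfolding M_def[symmetric] by (simp add: field_simps power2_eq_square)
qed

end

subsection \<open>Parameters of AdaNAG-G\<close>

text \<open>Closed forms of \<alpha> times \<tau>, of \<open>A\<close>, of \<open>B\<close> and of
  the second step size coefficient. The prescribed initial value of \<open>B\<close> is the general
  formula at index 0, hence \<open>nag_B\<close> has no case distinction.\<close>

definition nag_a :: "nat \<Rightarrow> real" where "nag_a k = sqrt (real k + 3)"
definition nag_A :: "nat \<Rightarrow> real" where "nag_A k = 2 * (real k + 4) - sqrt (real k + 4)"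
definition nag_B :: "nat \<Rightarrow> real" where
  "nag_B k = (real k + 3) * ((2 * sqrt (real k + 3) - 1)\<^sup>2 / (2 * (real k + 2)) - 1)"
definition nag_c :: "nat \<Rightarrow> real" where
  "nag_c k = inverse (nag_A k / nag_B k + (nag_B (Suc k) + (nag_a (Suc k))\<^sup>2) / nag_A k)"

lemma nag_A_ge: "real k + 4 \<le> nag_A k"
proof -
  have "sqrt (real k + 4) \<le> real k + 4"
    by (rule real_le_lsqrt) (auto simp: power2_eq_square algebra_simps)
  then show ?thesis by (simp add: nag_A_def)
qed

lemma nag_A_pos: "nag_A k > 0"
  using nag_A_ge[of k] by simp

lemma nag_B_pos: "nag_B k > 0"
proof -
  define u where "u = sqrt (real k + 3)"
  have u: "u\<^sup>2 = real k + 3"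
    by (simp add: u_def)
  \<comment> \<open>Here \<open>real k + 2\<close> is \<open>u\<^sup>2 - 1\<close>, and the square
    is completed.\<close>
  have "(2 * u - 1)\<^sup>2 - 2 * (real k + 2) = 2 * (u - 1)\<^sup>2 + 1"
    using u by (simp add: power2_eq_square algebra_simps)
  then have "2 * (real k + 2) < (2 * u - 1)\<^sup>2"
    using zero_le_power2[of "u - 1"] by linarith
  then have "1 < (2 * u - 1)\<^sup>2 / (2 * (real k + 2))"
    by simp
  then show ?thesis
    unfolding nag_B_def u_def[symmetric] by (intro mult_pos_pos) auto
qed

text \<open>The subtracted 1 in \<open>nag_B\<close> cancels against the square of
  \<open>nag_a\<close>. This makes the ratio condition \<open>s_ratio\<close> a consequence of the
  first step size bound.\<close>

lemma nag_B_Suc: "nag_B (Suc k) + (nag_a (Suc k))\<^sup>2 = (nag_A k)\<^sup>2 / (2 * (real k + 3))"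
proof -
  define u where "u = sqrt (real k + 4)"
  have u: "real k + 4 = u\<^sup>2" "u \<ge> 0"
    by (simp_all add: u_def)
  have k: "real (Suc k) + 3 = real k + 4" "real (Suc k) + 2 = real k + 3"
    by simp_all
  have "nag_A k = u * (2 * u - 1)"
    unfolding nag_A_def u_def[symmetric] unfolding u(1)
    using u(2) by (simp add: power2_eq_square right_diff_distrib)
  moreover have "nag_B (Suc k) + (nag_a (Suc k))\<^sup>2 = u\<^sup>2 * (2 * u - 1)\<^sup>2 / (2 * (real k + 3))"
    unfolding nag_B_def nag_a_def k u_def[symmetric] unfolding u(1)
    by (simp add: algebra_simps)
  ultimately show ?thesis
    by (simp add: power_mult_distrib)
qed

lemma nag_A_add: "nag_A k + nag_a (Suc k) = 2 * (real k + 4)"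
  by (simp add: nag_A_def nag_a_def add.commute)

text \<open>Ensures that the growth factors of the first bound are at least 1 from index 1
  on.\<close>

lemma nag_A_Suc_le: "nag_A (Suc k) \<le> 2 * (real k + 4)"
proof -
  have "2 \<le> sqrt (real k + 5)"
    by (rule real_le_rsqrt) simp
  then show ?thesis
    by (simp add: nag_A_def algebra_simps)
qed

section \<open>The second coefficient and growing sequences\<close>

lemma nag_c_pos: "nag_c k > 0"
proof -
  have "nag_A k / nag_B k > 0" "(nag_B (Suc k) + (nag_a (Suc k))\<^sup>2) / nag_A k \<ge> 0"
    using nag_A_pos[of k] nag_B_pos[of k] nag_B_pos[of "Suc k"] by simp_all
  then show ?thesis
    by (simp add: nag_c_def)
qed

text \<open>By \<open>nag_B_Suc\<close> the second summand is
  \<open>nag_A k / (2 * (real k + 3))\<close>, with limit 1; the first has limit 2.\<close>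

lemma nag_c_tendsto: "nag_c \<longlonglongrightarrow> 1 / 3"
  unfolding nag_c_def nag_B_Suc
  unfolding nag_A_def nag_B_def nag_a_def by real_asymp

text \<open>The square root in \<open>nag_A\<close> makes the right-hand side exceed 1 by order
  \<open>1 / sqrt k\<close>, the left-hand side only by \<open>1 / (k + 1)\<close>.\<close>

lemma eventually_nag_ratio_ge:
  "eventually (\<lambda>k. real (Suc (Suc k)) / real (Suc k) \<le> 2 * (real k + 4) / nag_A (Suc k)) sequentially"
  unfolding nag_A_def by real_asymp

text \<open>While \<open>s\<close> stays below \<open>b\<close>, the growth entry of the minimum
  applies and \<open>s\<close> dominates a linear function, so \<open>b\<close> is reached;
  afterwards both entries are at least \<open>b\<close>.\<close>

lemma eventually_ge_of_growth:
  fixes s :: "nat \<Rightarrow> real"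
  assumes pos: "\<And>k. s k > 0"
    and growth: "eventually (\<lambda>k. min (real (Suc k) / real k * s k) b \<le> s (Suc k)) sequentially"
  shows "eventually (\<lambda>k. b \<le> s k) sequentially"
proof -
  obtain N where N: "\<And>k. k \<ge> N \<Longrightarrow> min (real (Suc k) / real k * s k) b \<le> s (Suc k)" and "N > 0"
    using growth unfolding eventually_sequentially
    by (metis le_trans less_eq_Suc_le linorder_not_le nat_le_linear zero_less_Suc)
  have "\<exists>k\<ge>N. b \<le> s k"
  proof (rule ccontr)
    assume "\<not> ?thesis"
    then have less: "s k < b" if "k \<ge> N" for k
      using that by force
    have lin: "s N / real N * real k \<le> s k" if "k \<ge> N" for k
      using that
    proof (induction k rule: dec_induct)
      case base
      then show ?case using \<open>N > 0\<close> by simp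
    next
      case (step k)
      have "s N / real N * real (Suc k) = real (Suc k) / real k * (s N / real N * real k)"
        using \<open>N > 0\<close> step by simp
      also have "\<dots> \<le> real (Suc k) / real k * s k"
        using step by (intro mult_left_mono) auto
      also have "\<dots> \<le> s (Suc k)"
        using N[of k] less[of "Suc k"] step by linarith
      finally show ?case .
    qed
    obtain n where "b / (s N / real N) < real n"
      using reals_Archimedean2 by blast
    then have "b < s N / real N * real n"
      using pos[of N] \<open>N > 0\<close> by (simp add: field_simps)
    also have "\<dots> \<le> s N / real N * real (max n N)"
      using pos[of N] by (intro mult_left_mono) auto
    also have "\<dots> \<le> s (max n N)"
      by (rule lin) simp
    finally show False
      using less[of "max n N"] by simp
  qed
  then obtain K where K: "K \<ge> N" "b \<le> s K" by blast
  have "b \<le> s k" if "k \<ge> K" for k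
    using that
  proof (induction k rule: dec_induct)
    case (step k)
    have "1 * s k \<le> real (Suc k) / real k * s k"
      using pos[of k] K step \<open>N > 0\<close> by (intro mult_right_mono) (auto simp: field_simps)
    then show ?case
      using N[of k] K step by simp
  qed (fact K)
  then show ?thesis
    unfolding eventually_sequentially by blast
qed

section \<open>Identification of the coefficients with their closed forms\<close>

lemma nag_parameters:
  fixes \<alpha> \<tau> :: "int \<Rightarrow> real"
  assumes \<alpha>: "\<alpha> = (\<lambda>k. 1 / 2)" and \<tau>: "\<tau> = (\<lambda>k. 2 * sqrt (of_int k + 3))"
  shows coeff_A_nag: "coeff_A \<alpha> \<tau> (int k) = nag_A k"
    and coeff_A_minus_one: "coeff_A \<alpha> \<tau> (- 1) = 0"
    and coeff_B_nag: "coeff_B \<alpha> \<tau> (nag_B 0) (int k) = nag_B k"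
    and step_coeff_nag: "step_coeff \<alpha> \<tau> (nag_B 0) (int k) = nag_c k"
    and nag_B_0: "(\<alpha> 0)\<^sup>2 * (\<tau> 0)\<^sup>2 * ((\<tau> 0 - 1)\<^sup>2 / (\<alpha> (-1) * (\<tau> (-1))\<^sup>2) - 1) = nag_B 0"
    and nag_a_eq: "\<alpha> (int k) * \<tau> (int k) = nag_a k"
proof -
  show A: "coeff_A \<alpha> \<tau> (int k) = nag_A k" for k
    by (simp add: coeff_A_def nag_A_def \<alpha> \<tau> algebra_simps)
  show "coeff_A \<alpha> \<tau> (- 1) = 0"
    by (simp add: coeff_A_def)
  have "formula_B \<alpha> \<tau> (int k) = nag_B k" for k
  proof -
    have "(\<alpha> (int k))\<^sup>2 * (\<tau> (int k))\<^sup>2 = real k + 3"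
      "\<alpha> (int k - 1) * (\<tau> (int k - 1))\<^sup>2 = 2 * (real k + 2)"
      by (simp_all add: \<alpha> \<tau> power_mult_distrib power_divide)
    then show ?thesis
      by (simp add: formula_B_def nag_B_def \<tau>)
  qed
  then show B: "coeff_B \<alpha> \<tau> (nag_B 0) (int k) = nag_B k" for k
    by (simp add: coeff_B_def)
  show "step_coeff \<alpha> \<tau> (nag_B 0) (int k) = nag_c k"
    using A[of k] B[of k] B[of "Suc k"]
    by (simp add: step_coeff_def nag_c_def nag_a_def \<alpha> \<tau> power_mult_distrib power_divide add.commute)
  show "(\<alpha> 0)\<^sup>2 * (\<tau> 0)\<^sup>2 * ((\<tau> 0 - 1)\<^sup>2 / (\<alpha> (-1) * (\<tau> (-1))\<^sup>2) - 1) = nag_B 0"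
    by (simp add: nag_B_def \<alpha> \<tau> power_mult_distrib power_divide)
  show "\<alpha> (int k) * \<tau> (int k) = nag_a k"
    by (simp add: \<alpha> \<tau> nag_a_def)
qed

subsection \<open>Step sizes and rates\<close>

locale nag_half_run =
  fixes f :: "'a::euclidean_space \<Rightarrow> real" and L r L\<^sub>0 B\<^sub>0 :: real and m :: 'a
    and \<alpha> \<tau> :: "int \<Rightarrow> real" and x y z :: "nat \<Rightarrow> 'a" and s :: "nat \<Rightarrow> real"
  assumes \<alpha>: "\<alpha> = (\<lambda>k. 1 / 2)" and \<tau>: "\<tau> = (\<lambda>k. 2 * sqrt (of_int k + 3))" and B\<^sub>0: "B\<^sub>0 = nag_B 0"
    and smooth: "L_smooth L f" and convex: "convex_on UNIV f" and minimizer: "f m \<le> f u"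
    and run: "AdaNAG_G f \<alpha> \<tau> B\<^sub>0 x y z s"
    and r_pos: "r > 0" and r_le: "2 * r \<le> nag_c k"
    and L\<^sub>0: "0 < L\<^sub>0" "L\<^sub>0 \<le> L"
    and s_0: "s 0 = nag_A 0 / nag_a 0 * (2 * r) * (1 / L\<^sub>0)"
begin

lemma L_pos: "L > 0"
  using L\<^sub>0 by linarith

text \<open>Growth factor of the first step size bound; index 0 is special because
  \<open>coeff_A\<close> is set to 0 at -1.\<close>

definition q :: "nat \<Rightarrow> real" where
  "q k = (if k = 0 then nag_a 0 / nag_A 0 else 2 * (real k + 3) / nag_A k)"

lemma coeff_A_pred: "(coeff_A \<alpha> \<tau> (int k - 1) + nag_a k) / nag_A k = q k"
proof (cases k)
  case 0
  then show ?thesis by (simp add: q_def coeff_A_minus_one[OF \<alpha> \<tau>])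
next
  case (Suc j)
  then show ?thesis
    using nag_A_add[of j] by (simp add: q_def coeff_A_nag[OF \<alpha> \<tau>] add.commute)
qed

lemma run_s:
  "ereal (s (Suc k)) = min (ereal (q k * s k))
    (ereal (nag_c k) * (1 / local_smoothness f (x k) (x (Suc k))))"
  using run unfolding AdaNAG_G_def B\<^sub>0
  by (simp add: coeff_A_nag[OF \<alpha> \<tau>] step_coeff_nag[OF \<alpha> \<tau>] nag_a_eq[OF \<alpha> \<tau>] coeff_A_pred)

lemmas s_rule = step_size_rule[OF smooth convex nag_c_pos run_s]

lemma q_pos: "q k > 0"
  using nag_A_pos by (simp add: q_def nag_a_def)

lemma s_pos: "s k > 0"
proof (induction k)
  case 0
  then show ?case using run by (simp add: AdaNAG_G_def)
next
  case (Suc k)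
  have "0 < min (q k * s k) (nag_c k / L)"
    using Suc q_pos[of k] nag_c_pos[of k] L_pos by simp
  then show ?case
    using s_rule(2)[of k] by linarith
qed

lemma s_mult_A_le: "s (Suc k) * nag_A k \<le> 2 * (real k + 3) * s k"
proof -
  have "s (Suc k) * nag_A k \<le> q k * s k * nag_A k"
    using s_rule(1)[of k] nag_A_pos[of k] by (intro mult_right_mono) auto
  also have "\<dots> = (q k * nag_A k) * s k"
    by simp
  also have "\<dots> \<le> 2 * (real k + 3) * s k"
  proof (rule mult_right_mono)
    \<comment> \<open>Covers index 0, where \<open>q 0 * nag_A 0\<close> is \<open>nag_a 0\<close>,
      that is, \<open>sqrt 3\<close>.\<close>
    have "sqrt 3 \<le> (6 :: real)"
      by (rule real_le_lsqrt) auto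
    then show "q k * nag_A k \<le> 2 * (real k + 3)"
      using nag_A_pos[of k] by (simp add: q_def nag_a_def)
  qed (simp add: s_pos less_imp_le)
  finally show ?thesis .
qed

text \<open>Since \<open>q 0 < 1\<close>, induction starts at \<open>s 1\<close>: the choice of
  \<open>s 0\<close> cancels \<open>q 0\<close>, later growth factors are at least 1, and the second
  entry of the minimum is at least \<open>2 * r / L\<close>.\<close>

lemma s_ge: "2 * r / L \<le> s k"
proof (cases k)
  case 0
  have "nag_a 0 \<le> nag_A 0"
    using real_sqrt_le_mono[of 3 9] nag_A_ge[of 0] by (simp add: nag_a_def)
  then have "1 \<le> nag_A 0 / nag_a 0"
    by (simp add: nag_a_def)
  moreover have "2 * r / L \<le> 2 * r / L\<^sub>0"
    using L\<^sub>0 r_pos by (intro divide_left_mono) auto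
  moreover have "0 \<le> 2 * r / L\<^sub>0"
    using L\<^sub>0 r_pos by simp
  ultimately have "2 * r / L \<le> nag_A 0 / nag_a 0 * (2 * r / L\<^sub>0)"
    using mult_right_mono[of 1 "nag_A 0 / nag_a 0" "2 * r / L\<^sub>0"] by linarith
  then show ?thesis
    using 0 s_0 by simp
next
  case (Suc j)
  have "2 * r / L \<le> s (Suc j)"
  proof (induction j)
    case 0
    have "q 0 * s 0 = 2 * r / L\<^sub>0"
      using nag_A_pos[of 0] by (simp add: q_def s_0 nag_a_def)
    moreover have "2 * r / L \<le> 2 * r / L\<^sub>0"
      using L\<^sub>0 r_pos by (intro divide_left_mono) auto
    moreover have "2 * r / L \<le> nag_c 0 / L"
      using r_le[of 0] L_pos by (intro divide_right_mono) auto
    ultimately show ?case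
      using s_rule(2)[of 0] by linarith
  next
    case (Suc j)
    have "1 \<le> q (Suc j)"
      using nag_A_Suc_le[of j] nag_A_pos[of "Suc j"] by (simp add: q_def)
    then have "1 * s (Suc j) \<le> q (Suc j) * s (Suc j)"
      using s_pos[of "Suc j"] by (intro mult_right_mono) auto
    moreover have "2 * r / L \<le> nag_c (Suc j) / L"
      using r_le[of "Suc j"] L_pos by (intro divide_right_mono) auto
    ultimately show ?case
      using s_rule(2)[of "Suc j"] Suc by linarith
  qed
  then show ?thesis using Suc by simp
qed

sublocale adanag_iteration f L m nag_a nag_A nag_B x z s
proof
  fix k
  show "L_smooth L f" "convex_on UNIV f" "\<And>u. f m \<le> f u"
    using smooth convex minimizer by auto
  show "0 \<le> nag_a k" "0 < nag_A k" "0 < nag_B k" "0 < s k"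
    using nag_A_pos nag_B_pos s_pos by (auto simp: nag_a_def)
  show "z 0 = x 0"
    using run by (simp add: AdaNAG_G_def)
  have z: "z (Suc k) = z k - (s k * \<alpha> (int k) * \<tau> (int k)) *\<^sub>R gradient f (x k)" for k
    using run by (simp add: AdaNAG_G_def)
  then show "z (Suc k) = z k - (s k * nag_a k) *\<^sub>R gradient f (x k)"
    using nag_a_eq[OF \<alpha> \<tau>, of k] by (metis mult.assoc)
  show "nag_a (Suc k) *\<^sub>R (z (Suc k) - x (Suc k))
      = nag_A k *\<^sub>R (x (Suc k) - (x k - s k *\<^sub>R gradient f (x k)))"
  proof -
    define T where "T = \<tau> (int k + 1)"
    define Y where "Y = x k - s k *\<^sub>R gradient f (x k)"
    have T: "T > 0"
      by (simp add: T_def \<tau>)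
    have A: "nag_a (Suc k) * (T - 1) = nag_A k"
      using coeff_A_nag[OF \<alpha> \<tau>, of k] nag_a_eq[OF \<alpha> \<tau>, of "Suc k"]
      by (simp add: coeff_A_def T_def add.commute)
    have "x (Suc k) = (1 - 1 / T) *\<^sub>R Y + (1 / T) *\<^sub>R z (Suc k)"
      using run by (simp add: AdaNAG_G_def T_def Y_def)
    then have "T *\<^sub>R x (Suc k) = T *\<^sub>R ((1 - 1 / T) *\<^sub>R Y + (1 / T) *\<^sub>R z (Suc k))"
      by simp
    also have "\<dots> = (T - 1) *\<^sub>R Y + z (Suc k)"
      using T by (simp add: scaleR_right_distrib right_diff_distrib)
    finally have "z (Suc k) - x (Suc k) = (T - 1) *\<^sub>R (x (Suc k) - Y)"
      by (simp add: algebra_simps)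
    with A show ?thesis
      by (simp add: Y_def)
  qed
  show "s (Suc 0) * nag_A 0 \<le> s 0 * nag_a 0"
    using s_rule(1)[of 0] nag_A_pos[of 0] by (simp add: q_def field_simps)
  show "s (Suc (Suc k)) * nag_A (Suc k) \<le> s (Suc k) * (nag_A k + nag_a (Suc k))"
    using s_mult_A_le[of "Suc k"] by (simp add: nag_A_add algebra_simps)
  show "s (Suc k) * (nag_B (Suc k) + (nag_a (Suc k))\<^sup>2) \<le> nag_A k * s k"
  proof -
    \<comment> \<open>After rewriting with \<open>nag_B_Suc\<close>, the claim is the first bound
      times \<open>nag_A k\<close>.\<close>
    have "s (Suc k) * nag_A k * nag_A k \<le> 2 * (real k + 3) * s k * nag_A k"
      using s_mult_A_le[of k] nag_A_pos[of k] by (intro mult_right_mono) auto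
    then show ?thesis
      unfolding nag_B_Suc by (simp add: power2_eq_square field_simps)
  qed
  show "s (Suc k) * (norm (gradient f (x (Suc k)) - gradient f (x k)))\<^sup>2 / 2
      \<le> inverse (nag_A k / nag_B k + (nag_B (Suc k) + (nag_a (Suc k))\<^sup>2) / nag_A k)
        * (f (x k) - f (x (Suc k)) - gradient f (x (Suc k)) \<bullet> (x k - x (Suc k)))"
    using s_rule(3)[of k] by (simp add: nag_c_def)
qed

lemma eventually_s_ge:
  assumes "b < 1 / 3 * (1 / L)"
  shows "eventually (\<lambda>k. b \<le> s k) sequentially"
proof -
  have "b * L < 1 / 3"
    using assms L_pos by (simp add: field_simps)
  then have c: "eventually (\<lambda>k. b * L < nag_c k) sequentially"
    using order_tendstoD(1)[OF nag_c_tendsto] by blast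
  have "eventually (\<lambda>k. min (real (Suc k) / real k * s k) b \<le> s (Suc k)) sequentially"
    \<comment> \<open>The index is shifted by one because \<open>q\<close> has its general form only
      at positive indices.\<close>
    unfolding eventually_sequentially_Suc[symmetric,
        where P = "\<lambda>k. min (real (Suc k) / real k * s k) b \<le> s (Suc k)"]
    using eventually_nag_ratio_ge c[THEN eventually_sequentially_Suc[THEN iffD2]]
  proof eventually_elim
    case (elim k)
    have "real (Suc (Suc k)) / real (Suc k) * s (Suc k) \<le> q (Suc k) * s (Suc k)"
      using elim(1) s_pos[of "Suc k"] by (intro mult_right_mono) (auto simp: q_def algebra_simps)
    moreover have "b \<le> nag_c (Suc k) / L"
      using elim(2) L_pos by (simp add: field_simps)
    ultimately show ?case
      using s_rule(2)[of "Suc k"] by linarith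
  qed
  then show ?thesis
    using s_pos by (intro eventually_ge_of_growth)
qed

lemma liminf_s: "ereal (1 / 3 * (1 / L)) \<le> liminf (\<lambda>k. ereal (s k))"
  unfolding le_Liminf_iff
proof (intro allI impI)
  fix y assume "y < ereal (1 / 3 * (1 / L))"
  then obtain b where b: "y < ereal b" "ereal b < ereal (1 / 3 * (1 / L))"
    using ereal_dense2 by blast
  have "eventually (\<lambda>k. b \<le> s k) sequentially"
    using b by (intro eventually_s_ge) simp
  then show "eventually (\<lambda>k. y < ereal (s k)) sequentially"
    by eventually_elim (use b(1) in \<open>simp add: order_less_le_trans\<close>)
qed

section \<open>Convergence rates with explicit constants\<close>

lemma rates:
  assumes R: "R = (norm (x 0 - m))\<^sup>2
    + ((s 0)\<^sup>2 * (nag_B 0 + (nag_a 0)\<^sup>2) - s 0 * nag_a 0 / (2 * L)) * (norm (gradient f (x 0)))\<^sup>2"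
  shows "R \<ge> 0"
    and "f (x k) - f m \<le> 1 / s (Suc k) * (1 / (2 * nag_A k)) * R"
    and "1 \<le> k \<Longrightarrow> 1 / s (Suc k) * (1 / (2 * nag_A k)) * R \<le> 1 / (2 * r) * R * (L / real k)"
    and "1 \<le> k \<Longrightarrow> Min ((\<lambda>i. (norm (gradient f (x i)))\<^sup>2) ` {1..k})
      \<le> 1 / (2 * r\<^sup>2) * R * (L\<^sup>2 / (real k)\<^sup>2)"
proof -
  have E: "energy 0 \<le> R / 2"
    using energy_0 unfolding R .
  then show R0: "R \<ge> 0"
    using energy_nonneg[of 0] by linarith
  have "s (Suc k) * nag_A k * (f (x k) - f m) \<le> R / 2"
    using gap_le[of k] E by linarith
  then show "f (x k) - f m \<le> 1 / s (Suc k) * (1 / (2 * nag_A k)) * R"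
    using s_pos[of "Suc k"] nag_A_pos[of k] by (simp add: field_simps)
  show "1 / s (Suc k) * (1 / (2 * nag_A k)) * R \<le> 1 / (2 * r) * R * (L / real k)" if "1 \<le> k"
  proof -
    have "1 / s (Suc k) \<le> 1 / (2 * r / L)"
      using s_ge[of "Suc k"] r_pos L_pos s_pos[of "Suc k"] by (intro divide_left_mono) auto
    moreover have "1 / (2 * nag_A k) \<le> 1 / real k"
      using nag_A_ge[of k] that by (intro divide_left_mono) auto
    ultimately have "1 / s (Suc k) * (1 / (2 * nag_A k)) \<le> 1 / (2 * r / L) * (1 / real k)"
      using r_pos L_pos nag_A_pos[of k] by (intro mult_mono) auto
    then have "1 / s (Suc k) * (1 / (2 * nag_A k)) * R \<le> 1 / (2 * r / L) * (1 / real k) * R"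
      using R0 by (rule mult_right_mono)
    then show ?thesis by (simp add: mult_ac)
  qed
  show "Min ((\<lambda>i. (norm (gradient f (x i)))\<^sup>2) ` {1..k}) \<le> 1 / (2 * r\<^sup>2) * R * (L\<^sup>2 / (real k)\<^sup>2)"
    if "1 \<le> k"
  proof -
    have "real j \<le> nag_A j" for j
      using nag_A_ge[of j] by linarith
    \<comment> \<open>The uniform lower bound \<open>l\<close> is \<open>2 * r / L\<close>, from
      \<open>s_ge\<close>.\<close>
    then have "Min ((\<lambda>i. (norm (gradient f (x i)))\<^sup>2) ` {1..k})
        \<le> 4 * energy 0 / ((2 * r / L)\<^sup>2 * (real k)\<^sup>2)"
      using r_pos L_pos s_ge that by (intro min_gradient_le) auto
    also have "\<dots> \<le> 4 * (R / 2) / ((2 * r / L)\<^sup>2 * (real k)\<^sup>2)"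
      using E by (intro divide_right_mono) auto
    also have "\<dots> = 1 / (2 * r\<^sup>2) * R * (L\<^sup>2 / (real k)\<^sup>2)"
      by (simp add: power_divide power_mult_distrib)
    finally show ?thesis .
  qed
qed

end

text \<open>The constant \<open>C\<close> is chosen before \<open>f\<close>, \<open>L\<close> and
  the starting points, so the O-bounds are uniform in them. The general bound
  \<open>2 * r / L\<close> becomes \<open>1 / 5 * (1 / L)\<close> once \<open>r\<close> is at least
  1/10.\<close>

theorem corollary8:
  fixes \<alpha> \<tau> A B :: "int \<Rightarrow> real" and B\<^sub>0 r :: real
  assumes \<tau>: "\<tau> = (\<lambda>k. 2 * sqrt (of_int k + 3))"
    and \<alpha>: "\<alpha> = (\<lambda>k. 1 / 2)"
    and B0: "B\<^sub>0 = (\<alpha> 0)\<^sup>2 * (\<tau> 0)\<^sup>2 * ((\<tau> 0 - 1)\<^sup>2 / (\<alpha> (-1) * (\<tau> (-1))\<^sup>2) - 1)"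
    and A: "A = coeff_A \<alpha> \<tau>"
    and B: "B = coeff_B \<alpha> \<tau> B\<^sub>0"
    and r_pos: "r > 0"
    and r_le: "\<forall>k\<ge>0. inverse (A k / B k + (B (k + 1) + (\<alpha> (k + 1))\<^sup>2 * (\<tau> (k + 1))\<^sup>2) / A k)
                  \<ge> r / \<alpha> (k + 1)"
  shows "\<exists>C>0. \<forall>(f :: 'a::euclidean_space \<Rightarrow> real) L x_star x_tilde x y z s L\<^sub>0 R.
      L_smooth L f \<and> convex_on UNIV f \<and> (\<forall>u. f x_star \<le> f u) \<and>
      AdaNAG_G f \<alpha> \<tau> B\<^sub>0 x y z s \<and>
      x 0 \<noteq> x_tilde \<and>
      L\<^sub>0 = norm (gradient f (x 0) - gradient f x_tilde) / norm (x 0 - x_tilde) \<and> L\<^sub>0 > 0 \<and>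
      s 0 = A 0 / (\<alpha> 0 * \<tau> 0) * (r / \<alpha> 1) * (1 / L\<^sub>0) \<and>
      R = (norm (x 0 - x_star))\<^sup>2
          + ((s 0)\<^sup>2 * (B\<^sub>0 + (\<alpha> 0)\<^sup>2 * (\<tau> 0)\<^sup>2) - s 0 * \<alpha> 0 * \<tau> 0 / (2 * L))
            * (norm (gradient f (x 0)))\<^sup>2
      \<longrightarrow>
      (\<forall>k. f (x k) - f x_star
             \<le> 1 / s (k + 1) * (1 / (4 * (real k + 4 - sqrt (real k + 4) / 2))) * R) \<and>
      (\<forall>k\<ge>1. 1 / s (k + 1) * (1 / (4 * (real k + 4 - sqrt (real k + 4) / 2))) * R
             \<le> C * R * (L / real k)) \<and>
      (\<forall>k\<ge>1. Min ((\<lambda>i. (norm (gradient f (x i)))\<^sup>2) ` {1..k}) \<le> C * R * (L\<^sup>2 / (real k)\<^sup>2)) \<and>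
      (r \<ge> 1 / 10 \<longrightarrow> (\<forall>k. s k \<ge> 1 / 5 * (1 / L))) \<and>
      liminf (\<lambda>k. ereal (s k)) \<ge> ereal (1 / 3 * (1 / L))"
proof -
  have B\<^sub>0_eq: "B\<^sub>0 = nag_B 0"
    using B0 nag_B_0[OF \<alpha> \<tau>] by simp
  have c: "2 * r \<le> nag_c k" for k
    using r_le[rule_format, of "int k"] step_coeff_nag[OF \<alpha> \<tau>, of k]
    unfolding A B B\<^sub>0_eq step_coeff_def by (simp add: \<alpha>)
  \<comment> \<open>The sum dominates the constants of both rates.\<close>
  define C where "C = 1 / (2 * r) + 1 / (2 * r\<^sup>2)"
  have C: "C > 0" "1 / (2 * r) \<le> C" "1 / (2 * r\<^sup>2) \<le> C"
    using r_pos by (simp_all add: C_def add_pos_pos)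
  show ?thesis
  proof (intro exI[of _ C] conjI C(1) allI impI; elim conjE)
    fix f :: "'a \<Rightarrow> real" and L x_star x_tilde x y z s L\<^sub>0 R
    assume smooth: "L_smooth L f" and convex: "convex_on UNIV f" and minimizer: "\<forall>u. f x_star \<le> f u"
      and run: "AdaNAG_G f \<alpha> \<tau> B\<^sub>0 x y z s" and "x 0 \<noteq> x_tilde"
      and L\<^sub>0: "L\<^sub>0 = norm (gradient f (x 0) - gradient f x_tilde) / norm (x 0 - x_tilde)" "L\<^sub>0 > 0"
      and s_0: "s 0 = A 0 / (\<alpha> 0 * \<tau> 0) * (r / \<alpha> 1) * (1 / L\<^sub>0)"
      and R: "R = (norm (x 0 - x_star))\<^sup>2
          + ((s 0)\<^sup>2 * (B\<^sub>0 + (\<alpha> 0)\<^sup>2 * (\<tau> 0)\<^sup>2) - s 0 * \<alpha> 0 * \<tau> 0 / (2 * L))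
            * (norm (gradient f (x 0)))\<^sup>2"
    have L\<^sub>0_le: "L\<^sub>0 \<le> L"
      using L_smooth_norm_gradient_diff_le[OF smooth, of "x 0" x_tilde] \<open>x 0 \<noteq> x_tilde\<close>
      by (simp add: L\<^sub>0(1) divide_le_eq)
    have a_0: "\<alpha> 0 * \<tau> 0 = nag_a 0" and A_0: "A 0 = nag_A 0"
      using nag_a_eq[OF \<alpha> \<tau>, of 0] coeff_A_nag[OF \<alpha> \<tau>, of 0] by (simp_all add: A)
    interpret nag_half_run f L r L\<^sub>0 B\<^sub>0 x_star \<alpha> \<tau> x y z s
    proof
      show "s 0 = nag_A 0 / nag_a 0 * (2 * r) * (1 / L\<^sub>0)"
        using s_0 unfolding a_0 A_0 by (simp add: \<alpha>)
    qed (use \<alpha> \<tau> B\<^sub>0_eq smooth convex minimizer run r_pos c L\<^sub>0 L\<^sub>0_le in auto)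
    have R': "R = (norm (x 0 - x_star))\<^sup>2
        + ((s 0)\<^sup>2 * (nag_B 0 + (nag_a 0)\<^sup>2) - s 0 * nag_a 0 / (2 * L)) * (norm (gradient f (x 0)))\<^sup>2"
      unfolding R B\<^sub>0_eq a_0[symmetric] by (simp add: power_mult_distrib mult.assoc)
    have A_eq: "4 * (real k + 4 - sqrt (real k + 4) / 2) = 2 * nag_A k" for k
      by (simp add: nag_A_def)
    note rates = rates[OF R']
    show "f (x k) - f x_star
        \<le> 1 / s (k + 1) * (1 / (4 * (real k + 4 - sqrt (real k + 4) / 2))) * R" for k
      unfolding A_eq using rates(2)[of k] by simp
    show "1 / s (k + 1) * (1 / (4 * (real k + 4 - sqrt (real k + 4) / 2))) * R \<le> C * R * (L / real k)"
      if "1 \<le> k" for k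
    proof -
      have "1 / (2 * r) * R * (L / real k) \<le> C * R * (L / real k)"
        using C rates(1) L_pos by (intro mult_right_mono) auto
      with rates(3)[OF that] show ?thesis
        unfolding A_eq by simp
    qed
    show "Min ((\<lambda>i. (norm (gradient f (x i)))\<^sup>2) ` {1..k}) \<le> C * R * (L\<^sup>2 / (real k)\<^sup>2)"
      if "1 \<le> k" for k
    proof -
      have "1 / (2 * r\<^sup>2) * R * (L\<^sup>2 / (real k)\<^sup>2) \<le> C * R * (L\<^sup>2 / (real k)\<^sup>2)"
        using C rates(1) by (intro mult_right_mono) auto
      with rates(4)[OF that] show ?thesis
        by (rule order_trans)
    qed
    show "1 / 5 * (1 / L) \<le> s k" if "1 / 10 \<le> r" for k
    proof -
      have "1 / 5 * (1 / L) \<le> 2 * r / L"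
        using that L_pos by (simp add: field_simps)
      then show ?thesis
        using s_ge[of k] by (rule order_trans)
    qed
    show "ereal (1 / 3 * (1 / L)) \<le> liminf (\<lambda>k. ereal (s k))"
      by (rule liminf_s)
  qed
qed

end
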